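(* Let $n\ge1$ and $k\ge2$ be integers and put $s=3k+2n$, $K_1=1-\frac{1}{\sqrt2}-\frac{3k}{2}+\frac{3k}{\sqrt2}$, $K_2=1-\frac{3k}{2}+\frac{\sqrt{1-12k+18k^2}}{2}$, $K_3=1-\frac{3k}{2}+\frac{\sqrt{-1-6k+9k^2}}{\sqrt2}$, $K_4=1-\frac{3k}{2}+\frac{\sqrt{-7-12k+18k^2}}{2}$. Then $Mcut(R_{n,k})$ equals: (a) $\frac23$ if $n=1,k=2$; (b) $\frac{4}{s-2}$ if $k\ge4$, $3\mid n$, $2\mid k$ and $n<K_1$; (c) $\frac{4(s-2)}{(s-5)(s+1)}$ if $k\ge4$, $3\mid n$, $2\nmid k$ and $n<K_4$; (d) $\frac{4(s-2)}{(s-4)s}$ if $k\ge4$, $3\nmid n$, $2\mid k$ and $n<K_3$; (e) $\frac{4(s-2)}{(s-3)(s-1)}$ if ($k\ge4$, $3\nmid n$, $2\nmid k$ and $n<K_2$) or $(n,k)=(1,3)$ or $(n,k)=(2,3)$; (f) $\frac{6k+4n-4}{(2n-1)(6k+2n-3)}$ if either $k\ge4$ and [($3\mid n,2\mid k,K_1\le n$) or ($3\mid n,2\nmid k,K_4\le n$) or ($3\nmid n,2\mid k,K_3\le n$) or ($3\nmid n,2\nmid k,K_2\le n$)], or ($k=2$ and $n\ge2$), or ($k=3$ and $n\ge3$).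
   Context: $R_{n,k}$ ($n\ge1,k\ge2$) is the unweighted graph on vertices $x_1,\dots,x_{n+k},y_1,\dots,y_{n+k}$ with edges $x_ix_{i+1}$ and $y_iy_{i+1}$ for $1\le i\le n+k-1$, and $x_iy_i$ for $n+1\le i\le n+k$. For a graph $G=(V,E)$ with vertex degrees $d_v$: $vol(S)=\sum_{v\in S}d_v$; $cut(S,T)$ is the number of edges between disjoint sets $S,T$; $Ncut(S,T)=cut(S,T)\left(\frac1{vol(S)}+\frac1{vol(T)}\right)$; $Mcut(G)=\min\{Ncut(S,V\setminus S):\emptyset\ne S\subsetneq V\}$. *)

theory Defs
  imports Complex_Main
begin

text \<open>A finite simple graph is a pair of a vertex set and an edge set whose members are
  two-element vertex sets.\<close>

type_synonym 'a ugraph = "'a set \<times> 'a set set"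

abbreviation verts :: "'a ugraph \<Rightarrow> 'a set" where
  "verts G \<equiv> fst G"

abbreviation edges :: "'a ugraph \<Rightarrow> 'a set set" where
  "edges G \<equiv> snd G"

definition degree :: "'a ugraph \<Rightarrow> 'a \<Rightarrow> nat" where
  "degree G v = card {e \<in> edges G. v \<in> e}"

definition vol :: "'a ugraph \<Rightarrow> 'a set \<Rightarrow> nat" where
  "vol G S = (\<Sum>v\<in>S. degree G v)"

definition cut :: "'a ugraph \<Rightarrow> 'a set \<Rightarrow> 'a set \<Rightarrow> nat" where
  "cut G S T = card {e \<in> edges G. \<exists>u\<in>S. \<exists>v\<in>T. e = {u, v}}"

definition Ncut :: "'a ugraph \<Rightarrow> 'a set \<Rightarrow> 'a set \<Rightarrow> real" where
  "Ncut G S T = real (cut G S T) * (1 / real (vol G S) + 1 / real (vol G T))"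

definition Mcut :: "'a ugraph \<Rightarrow> real" where
  "Mcut G = Min {Ncut G S (verts G - S) | S. S \<noteq> {} \<and> S \<subset> verts G}"

datatype vertex = X nat | Y nat

definition R :: "nat \<Rightarrow> nat \<Rightarrow> vertex ugraph" where
  "R n k =
    (X ` {1..n+k} \<union> Y ` {1..n+k},
     {{X i, X (i+1)} | i. 1 \<le> i \<and> i \<le> n+k-1} \<union>
     {{Y i, Y (i+1)} | i. 1 \<le> i \<and> i \<le> n+k-1} \<union>
     {{X i, Y i} | i. n+1 \<le> i \<and> i \<le> n+k})"

end

theory Submission
  imports Defs
begin

text \<open>With total volume 2h, a cut S with c crossing edges and volume h + \<delta> has
  Ncut = 2hc / (h^2 - \<delta>^2). One-edge cuts remove a tail edge, and the best of them splits off a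
  whole tail. For k at least 3 and tails that are not too long, a two-edge cut either has volume far
  from h, or splits both paths at the same position of the ladder; the latter volumes lie in a
  residue class modulo 6, which determines how close to h they get. Three or more
  crossing edges are never better, even for \<delta> = 0. The thresholds compare the best one-edge cut with the best two-edge cut.\<close>

section \<open>Index sets encode vertex sets: degrees, volumes and cut sizes\<close>

locale roach =
  fixes n k :: nat
  assumes n: "1 \<le> n" and k: "2 \<le> k"
begin

abbreviation (input) half :: int where
  "half \<equiv> 2 * int n + 3 * int k - 2"

text \<open>The common degree of \<open>X i\<close> and \<open>Y i\<close>: the summands stand for
  the left neighbour, the right neighbour and the rung.\<close>

definition dg :: "nat \<Rightarrow> nat" where
  "dg i = of_bool (2 \<le> i) + of_bool (i < n + k) + of_bool (n < i)"

text \<open>A vertex set is encoded by the indices A of its X-vertices and B of its Y-vertices.\<close>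

definition chg :: "nat set \<Rightarrow> nat" where
  "chg A = card {i \<in> {1..<n+k}. (i \<in> A) \<noteq> (i + 1 \<in> A)}"

definition rungs :: "nat set \<Rightarrow> nat set \<Rightarrow> nat" where
  "rungs A B = card {i \<in> {n+1..n+k}. (i \<in> A) \<noteq> (i \<in> B)}"

lemma card_filter: "finite I \<Longrightarrow> card {i \<in> I. P i} = (\<Sum>i\<in>I. of_bool (P i))"
  by (simp add: sum_of_bool_eq Int_def)

lemma edges_R:
  "edges (R n k) = (\<lambda>i. {X i, X (i+1)}) ` {1..<n+k} \<union> (\<lambda>i. {Y i, Y (i+1)}) ` {1..<n+k}
     \<union> (\<lambda>i. {X i, Y i}) ` {n+1..n+k}"
proof -
  have "1 \<le> i \<and> i \<le> n + k - 1 \<longleftrightarrow> i \<in> {1..<n+k}" "n + 1 \<le> i \<and> i \<le> n + k \<longleftrightarrow> i \<in> {n+1..n+k}" for i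
    using n by auto
  then show ?thesis
    unfolding R_def snd_conv by (simp only: Setcompr_eq_image Collect_mem_eq)
qed

lemma verts_R: "verts (R n k) = X ` {1..n+k} \<union> Y ` {1..n+k}"
  by (simp add: R_def)

lemma finite_edges: "finite (edges (R n k))"
  by (simp add: edges_R)

text \<open>Degrees and cut sizes are both sums of indicators over the edge set. The three edge
  families are disjoint and injectively indexed, so such sums become sums over indices.\<close>

lemma sum_edges:
  fixes f :: "vertex set \<Rightarrow> nat"
  shows "(\<Sum>e\<in>edges (R n k). f e) = (\<Sum>i\<in>{1..<n+k}. f {X i, X (i+1)})
     + (\<Sum>i\<in>{1..<n+k}. f {Y i, Y (i+1)}) + (\<Sum>i\<in>{n+1..n+k}. f {X i, Y i})"
proof -
  have inj: "inj_on (\<lambda>i. {X i, X (i+1)}) I" "inj_on (\<lambda>i. {Y i, Y (i+1)}) I"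
    "inj_on (\<lambda>i. {X i, Y i}) I" for I
    by (auto simp: inj_on_def doubleton_eq_iff)
  let ?EX = "(\<lambda>i. {X i, X (i+1)}) ` {1..<n+k}" and ?EY = "(\<lambda>i. {Y i, Y (i+1)}) ` {1..<n+k}"
    and ?ER = "(\<lambda>i. {X i, Y i}) ` {n+1..n+k}"
  have "(?EX \<union> ?EY) \<inter> ?ER = {}" "?EX \<inter> ?EY = {}"
    by (auto simp: doubleton_eq_iff)
  then have "(\<Sum>e\<in>edges (R n k). f e) = sum f ?EX + sum f ?EY + sum f ?ER"
    unfolding edges_R by (simp add: sum.union_disjoint)
  then show ?thesis
    by (simp only: sum.reindex[OF inj(1)] sum.reindex[OF inj(2)] sum.reindex[OF inj(3)] o_def)
qed

lemma degree_R:
  assumes "i \<in> {1..n+k}"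
  shows "degree (R n k) (X i) = dg i" "degree (R n k) (Y i) = dg i"
proof -
  have d: "degree (R n k) v = (\<Sum>e\<in>edges (R n k). of_bool (v \<in> e))" for v
    by (simp add: degree_def card_filter finite_edges)
  have a: "(\<Sum>j\<in>{1..<n+k}. of_bool (i = j \<or> i = Suc j)) = (of_bool (2 \<le> i) + of_bool (i < n + k) :: nat)"
  proof -
    \<comment> \<open>The two cases exclude each other. As \<open>i\<close> is at least 1,
      \<open>i = Suc j\<close> may be read as \<open>j = i - 1\<close>; for \<open>i = 1\<close>
      this gives 0, outside the range.\<close>
    have "(\<Sum>j\<in>{1..<n+k}. of_bool (i = j \<or> i = Suc j))
        = (\<Sum>j\<in>{1..<n+k}. of_bool (i = j)) + (\<Sum>j\<in>{1..<n+k}. of_bool (j = i - 1) :: nat)"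
      unfolding sum.distrib[symmetric] using assms by (intro sum.cong) auto
    also have "\<dots> = of_bool (i \<in> {1..<n+k}) + of_bool (i - 1 \<in> {1..<n+k})"
      by (simp add: of_bool_def)
    finally show ?thesis using assms by (auto simp: of_bool_def)
  qed
  have b: "(\<Sum>j\<in>{n+1..n+k}. of_bool (i = j)) = (of_bool (n < i) :: nat)"
    using assms by (auto simp: of_bool_def)
  show "degree (R n k) (X i) = dg i" "degree (R n k) (Y i) = dg i"
    unfolding d sum_edges dg_def using a b by simp_all
qed

lemma vol_R:
  assumes "A \<subseteq> {1..n+k}" "B \<subseteq> {1..n+k}"
  shows "vol (R n k) (X ` A \<union> Y ` B) = sum dg A + sum dg B"
proof -
  have fin: "finite A" "finite B"
    using assms finite_subset by blast+
  have "vol (R n k) (X ` A \<union> Y ` B)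
      = (\<Sum>i\<in>A. degree (R n k) (X i)) + (\<Sum>i\<in>B. degree (R n k) (Y i))"
    unfolding vol_def using fin
    by (subst sum.union_disjoint) (auto simp: sum.reindex inj_on_def)
  also have "\<dots> = sum dg A + sum dg B"
    using assms degree_R by (intro arg_cong2[where f = "(+)"] sum.cong) auto
  finally show ?thesis .
qed

lemma compl_R:
  "verts (R n k) - (X ` A \<union> Y ` B) = X ` ({1..n+k} - A) \<union> Y ` ({1..n+k} - B)"
  by (auto simp: verts_R)

lemma cut_R:
  assumes "A \<subseteq> {1..n+k}" "B \<subseteq> {1..n+k}" "S = X ` A \<union> Y ` B"
  shows "cut (R n k) S (verts (R n k) - S) = chg A + chg B + rungs A B"
proof -
  let ?T = "X ` ({1..n+k} - A) \<union> Y ` ({1..n+k} - B)"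
  have T: "verts (R n k) - S = ?T"
    using compl_R assms(3) by simp
  have c: "cut (R n k) S ?T = (\<Sum>e\<in>edges (R n k). of_bool (\<exists>u\<in>S. \<exists>v\<in>?T. e = {u, v}))"
    by (simp add: cut_def card_filter finite_edges)
  have end_points: "(\<exists>u\<in>S. \<exists>v\<in>?T. {p, q} = {u, v}) \<longleftrightarrow> p \<in> S \<and> q \<in> ?T \<or> q \<in> S \<and> p \<in> ?T" for p q
    by (auto simp: doubleton_eq_iff)
  have x: "(\<exists>u\<in>S. \<exists>v\<in>?T. {X i, X (i+1)} = {u, v}) \<longleftrightarrow> (i \<in> A) \<noteq> (i + 1 \<in> A)"
    and y: "(\<exists>u\<in>S. \<exists>v\<in>?T. {Y i, Y (i+1)} = {u, v}) \<longleftrightarrow> (i \<in> B) \<noteq> (i + 1 \<in> B)"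
    if "i \<in> {1..<n+k}" for i
    using that assms unfolding end_points by auto
  have r: "(\<exists>u\<in>S. \<exists>v\<in>?T. {X i, Y i} = {u, v}) \<longleftrightarrow> (i \<in> A) \<noteq> (i \<in> B)"
    if "i \<in> {n+1..n+k}" for i
    using that assms unfolding end_points by auto
  show ?thesis
    unfolding T c sum_edges chg_def rungs_def card_filter[OF finite_atLeastLessThan] card_filter[OF finite_atLeastAtMost]
    by (intro arg_cong2[where f = "(+)"] sum.cong refl arg_cong[where f = of_bool] x y r)
qed

section \<open>Volumes along one path\<close>

lemma sum_dg_tail: "sum dg {1..n} = 2 * n - 1"
proof -
  have "sum dg {1..m} = 2 * m - 1" if "m \<le> n" for m
    using that k by (induction m) (auto simp: dg_def)
  then show ?thesis by blast
qed

text \<open>Ladder vertices have degree 3 except in the last column, where the degree is 2; hence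
  the strict bound on \<open>m\<close>.\<close>

lemma sum_dg_prefix: "m < k \<Longrightarrow> sum dg {1..n+m} = 2 * n - 1 + 3 * m"
  using sum_dg_tail n by (induction m) (auto simp: dg_def)

lemma sum_dg_all: "sum dg {1..n+k} = 2 * n + 3 * k - 2"
proof -
  obtain l where l: "k = Suc l" using k by (cases k) auto
  have "sum dg {1..n+k} = sum dg {1..n+l} + dg (n+k)"
    by (simp add: l)
  also have "dg (n+k) = 2" using n k by (simp add: dg_def)
  finally show ?thesis
    using sum_dg_prefix[of l] n by (simp add: l)
qed

lemma dg_pos: "i \<in> {1..n+k} \<Longrightarrow> 0 < dg i"
  using k by (simp add: dg_def) linarith

lemma sum_dg_compl:
  assumes "A \<subseteq> {1..n+k}"
  shows "int (sum dg ({1..n+k} - A)) = half - int (sum dg A)"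
proof -
  have "sum dg {1..n+k} = sum dg ({1..n+k} - A) + sum dg A"
    using assms by (rule sum.subset_diff) simp
  then show ?thesis using sum_dg_all n k by linarith
qed

section \<open>Sets with at most one change along a path\<close>

lemma chg_0:
  assumes "A \<subseteq> {1..n+k}" "chg A = 0"
  shows "A = {} \<or> A = {1..n+k}"
proof -
  have same: "(i \<in> A) = (i + 1 \<in> A)" if "1 \<le> i" "i < n + k" for i
    using assms(2) that by (auto simp: chg_def)
  have "(i \<in> A) = (1 \<in> A)" if "1 \<le> i" "i \<le> n + k" for i
    using that
  proof (induction i rule: dec_induct)
    case (step i)
    then show ?case using same[of i] by simp
  qed simp
  then show ?thesis using assms(1)
    by (metis atLeastAtMost_iff equals0I subsetD subsetI subset_antisym)
qed

text \<open>Membership is constant on each side of the single change and differs across it.\<close>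

lemma chg_1:
  assumes "A \<subseteq> {1..n+k}" "chg A = 1"
  obtains j where "1 \<le> j" "j < n + k" "A = {1..j} \<or> A = {1..n+k} - {1..j}"
proof -
  obtain j where j: "{i \<in> {1..<n+k}. (i \<in> A) \<noteq> (i + 1 \<in> A)} = {j}"
    using assms(2) unfolding chg_def by (meson card_1_singletonE)
  have jr: "1 \<le> j" "j < n + k" and jA: "(j \<in> A) \<noteq> (j + 1 \<in> A)"
    using j by auto
  have same: "(i \<in> A) = (i + 1 \<in> A)" if "1 \<le> i" "i < n + k" "i \<noteq> j" for i
    using j that by auto
  have lo: "(i \<in> A) = (1 \<in> A)" if "1 \<le> i" "i \<le> j" for i
    using that
  proof (induction i rule: dec_induct)
    case (step i)
    then show ?case using same[of i] jr by simp
  qed simp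
  have hi: "(i \<in> A) = (j + 1 \<in> A)" if "j + 1 \<le> i" "i \<le> n + k" for i
    using that
  proof (induction i rule: dec_induct)
    case (step i)
    then show ?case using same[of i] jr by simp
  qed simp
  have mem: "i \<in> A \<longleftrightarrow> (if i \<le> j then j \<in> A else j \<notin> A)" if "1 \<le> i" "i \<le> n + k" for i
    using lo[of i] lo[of j] hi[of i] that jr jA by auto
  have "i \<in> A \<longleftrightarrow> i \<in> (if j \<in> A then {1..j} else {1..n+k} - {1..j})" for i
    using assms(1) mem[of i] jr by (cases "i \<in> {1..n+k}") auto
  then have "A = (if j \<in> A then {1..j} else {1..n+k} - {1..j})" by blast
  then have "A = {1..j} \<or> A = {1..n+k} - {1..j}" by presburger
  then show ?thesis using that jr by blast
qed

section \<open>Volumes of cuts with one or two crossing edges\<close>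

lemma rungs_compl: "rungs ({1..n+k} - A) ({1..n+k} - B) = rungs A B"
  unfolding rungs_def by (rule arg_cong[of _ _ card]) auto

lemma rungs_sym: "rungs A B = rungs B A"
  unfolding rungs_def by (rule arg_cong[of _ _ card]) auto

text \<open>Against an empty opposite side every ladder index of \<open>A\<close> crosses its rung
  and contributes at most 3; the tail contributes at most \<open>2 * n - 1\<close>.\<close>

lemma sum_dg_rungs:
  assumes "A \<subseteq> {1..n+k}"
  shows "sum dg A \<le> 2 * n - 1 + 3 * rungs A {}"
proof -
  let ?L = "{i \<in> {n+1..n+k}. (i \<in> A) \<noteq> (i \<in> {})}"
  have "A \<subseteq> {1..n} \<union> ?L" using assms by auto
  then have "sum dg A \<le> sum dg ({1..n} \<union> ?L)"
    by (intro sum_mono2) auto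
  also have "\<dots> = sum dg {1..n} + sum dg ?L"
    by (intro sum.union_disjoint) auto
  also have "sum dg ?L \<le> 3 * card ?L"
    using sum_bounded_above[of ?L dg 3] by (simp add: dg_def mult.commute)
  finally show ?thesis using sum_dg_tail by (simp add: rungs_def)
qed

text \<open>If one path lies wholly outside the set, \<open>sum_dg_rungs\<close> bounds the volume
  from above, and \<open>half - (2 * n - 1)\<close> is \<open>3 * k - 1\<close>. If it lies wholly
  inside, complements reduce to this case.\<close>

lemma constant_side:
  assumes A: "A \<subseteq> {1..n+k}" and B: "B \<subseteq> {1..n+k}" and "chg A = 0 \<or> chg B = 0"
  shows "\<bar>int (sum dg A + sum dg B) - half\<bar> \<ge> 3 * int k - 1 - 3 * int (rungs A B)"
proof -
  have main: "\<bar>int (sum dg A + sum dg B) - half\<bar> \<ge> 3 * int k - 1 - 3 * int (rungs A B)"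
    if A: "A \<subseteq> {1..n+k}" and B: "B \<subseteq> {1..n+k}" and "chg B = 0" for A B
    using chg_0[OF B \<open>chg B = 0\<close>]
  proof
    assume "B = {}"
    then show ?thesis using sum_dg_rungs[OF A] n by (simp del: of_nat_sum)
  next
    assume "B = {1..n+k}"
    then show ?thesis
      using sum_dg_rungs[of "{1..n+k} - A"] sum_dg_compl[OF A] sum_dg_compl[of B] rungs_compl[of A B] n
      by (simp del: of_nat_sum)
  qed
  show ?thesis
    using assms(3) main[OF A B] main[OF B A] by (auto simp: rungs_sym add.commute)
qed

lemma rungs_constant:
  assumes "A \<subseteq> {1..n+k}" "B \<subseteq> {1..n+k}" "chg A = 0" "chg B = 0"
  shows "rungs A B = 0 \<or> rungs A B = k"
proof -
  have "{i \<in> {n+1..n+k}. (i \<in> A) \<noteq> (i \<in> B)} = {} \<or> {i \<in> {n+1..n+k}. (i \<in> A) \<noteq> (i \<in> B)} = {n+1..n+k}"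
    using chg_0[OF assms(1,3)] chg_0[OF assms(2,4)] by (elim disjE) auto
  then show ?thesis unfolding rungs_def by (elim disjE) simp_all
qed

text \<open>The crossing edge is no rung: with both paths uncut, either no rung crosses or all
  \<open>k\<close> do, and \<open>k\<close> is at least 2. The bound \<open>3 * k - 1\<close> is the
  deviation of a whole tail.\<close>

lemma cut_one:
  assumes A: "A \<subseteq> {1..n+k}" and B: "B \<subseteq> {1..n+k}" and "chg A + chg B + rungs A B = 1"
  shows "\<bar>int (sum dg A + sum dg B) - half\<bar> \<ge> 3 * int k - 1"
proof -
  have "chg A = 0 \<or> chg B = 0" using assms(3) by linarith
  moreover have "rungs A B = 0"
    using rungs_constant[OF A B] assms(3) k by (cases "chg A = 0 \<and> chg B = 0") auto
  ultimately show ?thesis using constant_side[OF A B] by simp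
qed

text \<open>Either both breaks lie in the tails (ends included), giving at most two full tails, or
  the absence of crossing rungs forces \<open>j = l\<close> inside the ladder, where each further
  column adds 6.\<close>

lemma cut_two_prefixes:
  assumes "1 \<le> j" "j < n + k" "1 \<le> l" "l < n + k" "rungs {1..j} {1..l} = 0"
  shows "int (sum dg {1..j} + sum dg {1..l}) \<le> 4 * int n - 2 \<or>
    (\<exists>m. int (sum dg {1..j} + sum dg {1..l}) = 4 * int n - 2 + 6 * int m)"
proof (cases "j \<le> n \<and> l \<le> n")
  case True
  then have "sum dg {1..j} \<le> sum dg {1..n}" "sum dg {1..l} \<le> sum dg {1..n}"
    by (auto intro!: sum_mono2)
  then show ?thesis using sum_dg_tail n by linarith
next
  case False
  have same: "i \<le> j \<longleftrightarrow> i \<le> l" if "n < i" "i \<le> n + k" for i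
    using assms(5) that by (auto simp: rungs_def)
  have "j = l" "n < j" using same[of j] same[of l] False assms by auto
  moreover from \<open>n < j\<close> have "sum dg {1..j} = 2 * n - 1 + 3 * (j - n)"
    using sum_dg_prefix[of "j - n"] assms(2) by simp
  ultimately show ?thesis using n by (intro disjI2 exI[of _ "j - n"]) simp
qed

text \<open>Two full tails have volume \<open>4 * n - 2\<close>, which is
  \<open>3 * k - 2 * n\<close> below \<open>half\<close>; the hypothesis \<open>nk\<close> makes
  this at least 3.\<close>

lemma cut_two:
  assumes A: "A \<subseteq> {1..n+k}" and B: "B \<subseteq> {1..n+k}" and cut: "chg A + chg B + rungs A B = 2"
    and k3: "3 \<le> k" and nk: "2 * n + 3 \<le> 3 * k"
  shows "\<bar>int (sum dg A + sum dg B) - half\<bar> \<ge> 3 \<or>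
    (\<exists>m. \<bar>int (sum dg A + sum dg B) - half\<bar> = \<bar>2 * int n + 6 * m - 3 * int k\<bar>)"
proof (cases "chg A = 0 \<or> chg B = 0")
  case True
  \<comment> \<open>If both paths were uncut, 0 or \<open>k\<close> rungs would cross, never 2 as
    \<open>k\<close> is at least 3. So a path edge crosses, leaving at most one rung.\<close>
  have "rungs A B \<le> 1"
    using rungs_constant[OF A B] True cut k3 by (cases "chg A = 0 \<and> chg B = 0") auto
  then show ?thesis using constant_side[OF A B True] k3 by linarith
next
  case False
  then have c: "chg A = 1" "chg B = 1" "rungs A B = 0" using cut by auto
  obtain j where j: "1 \<le> j" "j < n + k" "A = {1..j} \<or> A = {1..n+k} - {1..j}"
    using chg_1[OF A c(1)] .
  obtain l where l: "1 \<le> l" "l < n + k" "B = {1..l} \<or> B = {1..n+k} - {1..l}"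
    using chg_1[OF B c(2)] .
  \<comment> \<open>The last rung does not cross, so \<open>A\<close> and \<open>B\<close> are both
    prefixes or both complements of prefixes.\<close>
  have "n + k \<in> A \<longleftrightarrow> n + k \<in> B" using c(3) k by (auto simp: rungs_def)
  then consider "A = {1..j}" "B = {1..l}" | "A = {1..n+k} - {1..j}" "B = {1..n+k} - {1..l}"
    using j l k by auto
  then have r: "rungs {1..j} {1..l} = 0"
    and dev: "\<bar>int (sum dg A + sum dg B) - half\<bar> = \<bar>int (sum dg {1..j} + sum dg {1..l}) - half\<bar>"
    using c(3) j l rungs_compl sum_dg_compl[of "{1..j}"] sum_dg_compl[of "{1..l}"]
    by (cases; simp)+
  show ?thesis
    unfolding dev using cut_two_prefixes[OF j(1,2) l(1,2) r]
  proof
    assume "\<exists>m. int (sum dg {1..j} + sum dg {1..l}) = 4 * int n - 2 + 6 * int m"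
    then obtain m where "int (sum dg {1..j} + sum dg {1..l}) = 4 * int n - 2 + 6 * int m" ..
    then show "3 \<le> \<bar>int (sum dg {1..j} + sum dg {1..l}) - half\<bar> \<or>
      (\<exists>m. \<bar>int (sum dg {1..j} + sum dg {1..l}) - half\<bar> = \<bar>2 * int n + 6 * m - 3 * int k\<bar>)"
      by (intro disjI2 exI[of _ "int m"]) simp
  qed (use nk in linarith)
qed

section \<open>Residues modulo 6 of the ladder volumes\<close>

text \<open>The least distance from half the total volume to the volume of a cut through the ladder.\<close>

definition dev :: int where
  "dev = (if 3 dvd n then if even k then 0 else 3 else if even k then 2 else 1)"

lemma offset_mod_6: "2 * int n + 6 * m - 3 * int k
    = 6 * (m + int (n div 3) - int (k div 2)) + 2 * int (n mod 3) - 3 * int (k mod 2)"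
proof -
  have "int (3 * (n div 3) + n mod 3) = int n" "int (2 * (k div 2) + k mod 2) = int k"
    by (simp_all only: mult_div_mod_eq)
  then show ?thesis unfolding of_nat_add of_nat_mult by simp
qed

lemma dev_le: "\<bar>2 * int n + 6 * m - 3 * int k\<bar> \<ge> dev"
proof -
  obtain c where c: "2 * int n + 6 * m - 3 * int k = 6 * c + 2 * int (n mod 3) - 3 * int (k mod 2)"
    using offset_mod_6 by blast
  have "n mod 3 = 0 \<or> n mod 3 = 1 \<or> n mod 3 = 2" "k mod 2 = 0 \<or> k mod 2 = 1"
    by auto
  then show ?thesis
    unfolding c dev_def dvd_eq_mod_eq_0 by (elim disjE) (simp; presburger)+
qed

text \<open>The bound \<open>m < k\<close> makes the optimal column position realizable by a cut;
  \<open>2 * n + 3 \<le> 3 * k\<close> keeps it nonnegative.\<close>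

lemma dev_attained:
  assumes "2 * n + 3 \<le> 3 * k"
  shows "\<exists>m<k. \<bar>2 * int n + 6 * int m - 3 * int k\<bar> = dev"
proof -
  have r: "n mod 3 = 0 \<or> n mod 3 = 1 \<or> n mod 3 = 2" "k mod 2 = 0 \<or> k mod 2 = 1"
    by auto
  define c where "c = int (k div 2) - int (n div 3)"
  \<comment> \<open>With \<open>m = c\<close> the offset is
    \<open>2 * (n mod 3) - 3 * (k mod 2)\<close>, already of absolute value \<open>dev\<close>
    except for the value 4, when \<open>n mod 3 = 2\<close> and \<open>k\<close> is even. One column
    less then gives -2.\<close>
  define m where "m = nat (if n mod 3 = 2 then c - of_bool (even k) else c)"
  have off: "2 * int n - 3 * int k = 2 * int (n mod 3) - 3 * int (k mod 2) - 6 * c"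
    using offset_mod_6[of 0] by (simp add: c_def)
  have "0 \<le> (if n mod 3 = 2 then c - of_bool (even k) else c)"
    using r off assms by (elim disjE) (auto simp: even_iff_mod_2_eq_zero)
  then have m: "int m = (if n mod 3 = 2 then c - of_bool (even k) else c)"
    by (simp add: m_def)
  have "int m < int k" using r off m k by (elim disjE) (auto simp: c_def)
  moreover have "\<bar>2 * int n + 6 * int m - 3 * int k\<bar> = dev"
    using r off m by (elim disjE) (auto simp: dev_def dvd_eq_mod_eq_0)
  ultimately show ?thesis by (intro exI[of _ m]) simp
qed

lemma cut_two_dev:
  assumes "A \<subseteq> {1..n+k}" "B \<subseteq> {1..n+k}" "chg A + chg B + rungs A B = 2" "3 \<le> k" "2 * n + 3 \<le> 3 * k"
  shows "dev \<le> \<bar>int (sum dg A + sum dg B) - half\<bar>"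
  using cut_two[OF assms]
proof
  assume "3 \<le> \<bar>int (sum dg A + sum dg B) - half\<bar>"
  moreover have "dev \<le> 3" by (simp add: dev_def)
  ultimately show ?thesis by linarith
qed (metis dev_le)

section \<open>Normalized cuts and a criterion for the minimum\<close>

lemma sum_dg_bounds:
  assumes "A \<subseteq> {1..n+k}" "B \<subseteq> {1..n+k}"
    and "A \<noteq> {} \<or> B \<noteq> {}" "A \<noteq> {1..n+k} \<or> B \<noteq> {1..n+k}"
  shows "\<bar>int (sum dg A + sum dg B) - half\<bar> < half"
proof -
  have pos: "0 < sum dg C" if "C \<subseteq> {1..n+k}" "C \<noteq> {}" for C
  proof (rule sum_pos)
    show "finite C" using that(1) by (rule finite_subset) simp
    show "0 < dg i" if "i \<in> C" for i using \<open>C \<subseteq> {1..n+k}\<close> that dg_pos by blast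
  qed (rule that(2))
  have "{1..n+k} - A \<noteq> {} \<or> {1..n+k} - B \<noteq> {}" using assms by blast
  then have "0 < sum dg ({1..n+k} - A) + sum dg ({1..n+k} - B)"
    by (elim disjE) (metis Diff_subset add_gr_0 pos)+
  moreover have "0 < sum dg A + sum dg B"
    using pos assms by (metis add_gr_0)
  ultimately show ?thesis
    using sum_dg_compl[OF assms(1)] sum_dg_compl[OF assms(2)] by linarith
qed

text \<open>The two volumes are \<open>half + \<delta>\<close> and \<open>half - \<delta>\<close>,
  so their reciprocals add up to
  \<open>2 * half / (half\<^sup>2 - \<delta>\<^sup>2)\<close>.\<close>

lemma Ncut_R:
  assumes "A \<subseteq> {1..n+k}" "B \<subseteq> {1..n+k}" "S = X ` A \<union> Y ` B" "S \<noteq> {}" "S \<noteq> verts (R n k)"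
    and \<delta>: "\<delta> = int (sum dg A + sum dg B) - half"
  shows "Ncut (R n k) S (verts (R n k) - S)
    = 2 * half * (chg A + chg B + rungs A B) / (half\<^sup>2 - \<delta>\<^sup>2)" "\<delta>\<^sup>2 < half\<^sup>2"
proof -
  define v w where "v = sum dg A + sum dg B" and "w = sum dg ({1..n+k} - A) + sum dg ({1..n+k} - B)"
  have "A \<noteq> {} \<or> B \<noteq> {}" "A \<noteq> {1..n+k} \<or> B \<noteq> {1..n+k}"
    using assms by (auto simp: verts_R)
  from sum_dg_bounds[OF assms(1,2) this] have lt: "\<bar>\<delta>\<bar> < half" by (simp only: \<delta>)
  then show "\<delta>\<^sup>2 < half\<^sup>2" using power_strict_mono[OF lt abs_ge_zero, of 2] by simp
  have v: "real v = half + \<delta>" and w: "real w = half - \<delta>"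
    using \<delta> sum_dg_compl[OF assms(1)] sum_dg_compl[OF assms(2)] unfolding v_def w_def by linarith+
  have "vol (R n k) S = v" "vol (R n k) (verts (R n k) - S) = w"
    using vol_R[OF assms(1,2)] vol_R[of "{1..n+k} - A" "{1..n+k} - B"] compl_R[of A B]
    by (simp_all add: assms(3) v_def w_def)
  then have "Ncut (R n k) S (verts (R n k) - S)
      = (chg A + chg B + rungs A B) * (1 / real v + 1 / real w)"
    using cut_R[OF assms(1-3)] by (simp add: Ncut_def)
  also have "1 / real v + 1 / real w = 2 * half / (half\<^sup>2 - \<delta>\<^sup>2)"
  proof -
    have "real v * real w = half\<^sup>2 - \<delta>\<^sup>2"
      unfolding v w by (simp add: power2_eq_square algebra_simps)
    moreover have "real v + real w = 2 * half" unfolding v w by simp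
    moreover have "real v > 0" "real w > 0" unfolding v w using lt by linarith+
    ultimately show ?thesis by (simp add: add_frac_eq add.commute)
  qed
  finally show "Ncut (R n k) S (verts (R n k) - S)
    = 2 * half * (chg A + chg B + rungs A B) / (half\<^sup>2 - \<delta>\<^sup>2)" by simp
qed

text \<open>The graph is connected: uncut paths are constant, and the last rung ties them
  together.\<close>

lemma cut_pos:
  assumes "A \<subseteq> {1..n+k}" "B \<subseteq> {1..n+k}" "S = X ` A \<union> Y ` B" "S \<noteq> {}" "S \<noteq> verts (R n k)"
  shows "1 \<le> chg A + chg B + rungs A B"
proof (rule ccontr)
  assume "\<not> ?thesis"
  then have c: "chg A = 0" "chg B = 0" "rungs A B = 0" by auto
  have "n + k \<in> A \<longleftrightarrow> n + k \<in> B" using c(3) k by (auto simp: rungs_def)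
  then have "A = {} \<and> B = {} \<or> A = {1..n+k} \<and> B = {1..n+k}"
    using chg_0[OF assms(1) c(1)] chg_0[OF assms(2) c(2)] k by auto
  then show False using assms(3-5) by (auto simp: verts_R)
qed

text \<open>A cut with \<open>c\<close> crossing edges has \<open>Ncut\<close> at least
  \<open>2 * half / q\<close> exactly when
  \<open>half\<^sup>2 - \<delta>\<^sup>2 \<le> c * q\<close>. The first three assumptions secure
  this for \<open>c = 1\<close>, \<open>c = 2\<close> and \<open>c \<ge> 3\<close>; the last ones
  name a cut with equality.\<close>

lemma Mcut_eqI:
  fixes q :: real
  assumes one: "half\<^sup>2 - (3 * int k - 1)\<^sup>2 \<le> q"
    and two: "\<And>A B. A \<subseteq> {1..n+k} \<Longrightarrow> B \<subseteq> {1..n+k} \<Longrightarrow> chg A + chg B + rungs A B = 2 \<Longrightarrow>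
      half\<^sup>2 - (int (sum dg A + sum dg B) - half)\<^sup>2 \<le> 2 * q"
    and three: "half\<^sup>2 \<le> 3 * q"
    and attained: "A \<subseteq> {1..n+k}" "B \<subseteq> {1..n+k}" "0 < chg A + chg B + rungs A B"
      "half\<^sup>2 - (int (sum dg A + sum dg B) - half)\<^sup>2 = (chg A + chg B + rungs A B) * q"
  shows "Mcut (R n k) = 2 * half / q"
proof -
  let ?V = "verts (R n k)"
  let ?N = "\<lambda>S. Ncut (R n k) S (?V - S)"
  have h: "half > 0" using n k by simp
  then have "0 < real_of_int (half\<^sup>2)" by (metis of_int_0_less_iff zero_less_power)
  then have q: "0 < q" using three by linarith
  have finV: "finite ?V" by (simp add: verts_R)
  have "{?N S | S. S \<noteq> {} \<and> S \<subset> ?V} \<subseteq> ?N ` Pow ?V" by blast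
  then have fin: "finite {?N S | S. S \<noteq> {} \<and> S \<subset> ?V}"
    using finV by (meson finite_Pow_iff finite_imageI finite_subset)
  have lower: "2 * half / q \<le> ?N S" if "S \<noteq> {}" "S \<subset> ?V" for S
  proof -
    define A B where "A = {i. X i \<in> S}" and "B = {i. Y i \<in> S}"
    have S: "S = X ` A \<union> Y ` B"
      unfolding A_def B_def by (auto simp: image_iff) (metis vertex.exhaust)
    have AB: "A \<subseteq> {1..n+k}" "B \<subseteq> {1..n+k}"
      using that(2) by (auto simp: A_def B_def verts_R)
    define c where "c = chg A + chg B + rungs A B"
    define \<delta> where "\<delta> = int (sum dg A + sum dg B) - half"
    have N: "?N S = 2 * half * c / (half\<^sup>2 - \<delta>\<^sup>2)" and lt: "\<delta>\<^sup>2 < half\<^sup>2"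
      using Ncut_R[OF AB S that(1) _ \<delta>_def] that(2) by (auto simp: c_def)
    have "1 \<le> c" using cut_pos[OF AB S] that unfolding c_def by blast
    then consider "c = 1" | "c = 2" | "3 \<le> c" by linarith
    then have "half\<^sup>2 - \<delta>\<^sup>2 \<le> c * q"
    proof cases
      case 1
      have "(3 * int k - 1)\<^sup>2 \<le> \<delta>\<^sup>2"
        using cut_one[OF AB] 1 k unfolding c_def \<delta>_def by (intro abs_le_square_iff[THEN iffD1]) auto
      then have "real_of_int ((3 * int k - 1)\<^sup>2) \<le> real_of_int (\<delta>\<^sup>2)" by (simp only: of_int_le_iff)
      then show ?thesis using one 1 by simp
    next
      case 2
      then show ?thesis using two[OF AB] unfolding c_def \<delta>_def by simp
    next
      case 3
      then have "3 * q \<le> c * q" using q by simp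
      moreover have "0 \<le> real_of_int (\<delta>\<^sup>2)" by simp
      ultimately show ?thesis using three by linarith
    qed
    moreover have "0 < real_of_int (half\<^sup>2 - \<delta>\<^sup>2)" using lt by (simp only: of_int_0_less_iff diff_gt_0_iff_gt)
    ultimately have "1 / q \<le> c / (half\<^sup>2 - \<delta>\<^sup>2)"
      using q by (simp add: field_simps)
    then have "2 * half * (1 / q) \<le> 2 * half * (c / (half\<^sup>2 - \<delta>\<^sup>2))"
      using h by (intro mult_left_mono) auto
    then show ?thesis unfolding N by simp
  qed
  define S where "S = X ` A \<union> Y ` B"
  have q': "half\<^sup>2 - (int (sum dg A + sum dg B) - half)\<^sup>2 > 0"
  proof -
    have "0 < (chg A + chg B + rungs A B) * q" using attained(3) q by (intro mult_pos_pos) auto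
    then show ?thesis unfolding attained(4)[symmetric] by (simp only: of_int_0_less_iff)
  qed
  \<comment> \<open>The empty set and the full vertex set have deviation \<open>-half\<close> and
    \<open>half\<close>, which would make the positive quantity \<open>q'\<close> vanish.\<close>
  have ne: "S \<noteq> {}"
  proof
    assume "S = {}"
    then have "A = {}" "B = {}" by (auto simp: S_def)
    then show False using q' by (simp add: power2_commute[of 2 "2 * int n + 3 * int k"])
  qed
  have ne': "S \<noteq> ?V"
  proof
    assume "S = ?V"
    then have "A = {1..n+k}" "B = {1..n+k}" unfolding S_def verts_R by blast+
    then show False using q' sum_dg_compl[of A] by simp
  qed
  have "?N S = 2 * half * (chg A + chg B + rungs A B) / ((chg A + chg B + rungs A B) * q)"
    unfolding attained(4)[symmetric] by (rule Ncut_R(1)[OF attained(1,2) S_def ne ne' refl])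
  also have "\<dots> = 2 * half / q" using attained(3) by (simp del: of_nat_add)
  finally have N: "2 * half / q = ?N S" ..
  have "S \<subset> ?V" using attained ne' by (auto simp: S_def verts_R)
  then have "2 * half / q \<in> {?N S | S. S \<noteq> {} \<and> S \<subset> ?V}"
    using ne N by blast
  then show ?thesis unfolding Mcut_def
    using lower by (intro Min_eqI fin) auto
qed

section \<open>The two regimes: splitting off a tail or halving the ladder\<close>

lemma chg_prefix: "1 \<le> j \<Longrightarrow> j < n + k \<Longrightarrow> chg {1..j} = 1"
proof -
  assume "1 \<le> j" "j < n + k"
  then have "{i \<in> {1..<n+k}. (i \<in> {1..j}) \<noteq> (i + 1 \<in> {1..j})} = {j}" by auto
  then show ?thesis by (simp add: chg_def)
qed

text \<open>A two-edge cut with deviation \<open>\<delta>\<close> is no better than a whole tail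
  when \<open>2 * (3 * k - 1)\<^sup>2 \<le> half\<^sup>2 + \<delta>\<^sup>2\<close>. The
  alternatives insert the trivial bound 0 and the bound \<open>dev\<close> for the absolute value of
  \<open>\<delta>\<close>.\<close>

lemma Mcut_tail:
  assumes "2 * (3 * int k - 1)\<^sup>2 \<le> half\<^sup>2 \<or>
    (3 \<le> k \<and> 2 * n + 3 \<le> 3 * k \<and> 2 * (3 * int k - 1)\<^sup>2 \<le> half\<^sup>2 + dev\<^sup>2)"
  shows "Mcut (R n k) = 2 * half / (half\<^sup>2 - (3 * int k - 1)\<^sup>2)"
proof -
  let ?q = "half\<^sup>2 - (3 * int k - 1)\<^sup>2"
  have two: "half\<^sup>2 - (int (sum dg A + sum dg B) - half)\<^sup>2 \<le> 2 * ?q"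
    if AB: "A \<subseteq> {1..n+k}" "B \<subseteq> {1..n+k}" "chg A + chg B + rungs A B = 2" for A B
    using assms
  proof
    assume a: "2 * (3 * int k - 1)\<^sup>2 \<le> half\<^sup>2"
    have "0 \<le> (int (sum dg A + sum dg B) - half)\<^sup>2" by simp
    then show ?thesis using a unfolding right_diff_distrib by linarith
  next
    assume a: "3 \<le> k \<and> 2 * n + 3 \<le> 3 * k \<and> 2 * (3 * int k - 1)\<^sup>2 \<le> half\<^sup>2 + dev\<^sup>2"
    then have "dev\<^sup>2 \<le> (int (sum dg A + sum dg B) - half)\<^sup>2"
      using cut_two_dev[OF AB] by (intro abs_le_square_iff[THEN iffD1]) (auto simp: dev_def)
    then show ?thesis using a unfolding right_diff_distrib by linarith
  qed
  have three: "half\<^sup>2 \<le> 3 * ?q"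
    using assms
  proof
    assume "2 * (3 * int k - 1)\<^sup>2 \<le> half\<^sup>2"
    moreover have "0 \<le> half\<^sup>2" by simp
    ultimately show ?thesis unfolding right_diff_distrib by linarith
  next
    assume a: "3 \<le> k \<and> 2 * n + 3 \<le> 3 * k \<and> 2 * (3 * int k - 1)\<^sup>2 \<le> half\<^sup>2 + dev\<^sup>2"
    have "dev\<^sup>2 \<le> 9" by (simp add: dev_def)
    \<comment> \<open>The second alternative leaves
      \<open>3 * dev\<^sup>2 \<le> half\<^sup>2\<close> to be checked, and \<open>3 * 9\<close> is
      below 81.\<close>
    moreover have "9\<^sup>2 \<le> half\<^sup>2" using a n by (intro power_mono) auto
    ultimately show ?thesis using a unfolding right_diff_distrib by (simp del: of_nat_add)
  qed
  have tail: "{1..n} \<subseteq> {1..n+k}" "{} \<subseteq> {1..n+k}" by auto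
  have c: "chg {1..n} + chg {} + rungs {1..n} {} = 1"
    using chg_prefix[of n] n k by (auto simp: chg_def rungs_def)
  have d: "(int (sum dg {1..n} + sum dg {}) - half)\<^sup>2 = (3 * int k - 1)\<^sup>2"
    using sum_dg_tail n by (intro power2_eq_iff[THEN iffD2] disjI2) (simp add: of_nat_diff del: of_nat_sum)
  show ?thesis
  proof (rule Mcut_eqI[OF _ _ _ tail, unfolded c d])
    have le: "a \<le> 2 * b \<Longrightarrow> real_of_int a \<le> 2 * real_of_int b"
      "a \<le> 3 * b \<Longrightarrow> real_of_int a \<le> 3 * real_of_int b" for a b
      by linarith+
    show "real_of_int (half\<^sup>2) \<le> 3 * real_of_int ?q"
      by (rule le(2)[OF three])
    show "real_of_int (half\<^sup>2 - (int (sum dg A + sum dg B) - half)\<^sup>2) \<le> 2 * real_of_int ?q"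
      if "A \<subseteq> {1..n+k}" "B \<subseteq> {1..n+k}" "chg A + chg B + rungs A B = 2" for A B
      by (rule le(1)[OF two[OF that]])
  qed simp_all
qed

text \<open>Here the optimal cut takes the same prefix of both paths, with the column from
  \<open>dev_attained\<close>. The assumption \<open>le\<close> is the comparison with a whole
  tail.\<close>

lemma Mcut_ladder:
  assumes k3: "3 \<le> k" and nk: "2 * n + 3 \<le> 3 * k" and le: "half\<^sup>2 + dev\<^sup>2 \<le> 2 * (3 * int k - 1)\<^sup>2"
  shows "Mcut (R n k) = 4 * half / (half\<^sup>2 - dev\<^sup>2)"
proof -
  obtain m where m: "m < k" "\<bar>2 * int n + 6 * int m - 3 * int k\<bar> = dev"
    using dev_attained[OF nk] by blast
  let ?A = "{1..n+m}"
  have two: "half\<^sup>2 - (int (sum dg A + sum dg B) - half)\<^sup>2 \<le> half\<^sup>2 - dev\<^sup>2"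
    if AB: "A \<subseteq> {1..n+k}" "B \<subseteq> {1..n+k}" "chg A + chg B + rungs A B = 2" for A B
    using cut_two_dev[OF AB k3 nk]
    by (intro diff_left_mono abs_le_square_iff[THEN iffD1]) (auto simp: dev_def)
  have dev9: "dev\<^sup>2 \<le> 9" by (simp add: dev_def)
  moreover have "9\<^sup>2 \<le> half\<^sup>2" using k3 n by (intro power_mono) auto
  ultimately have three: "2 * half\<^sup>2 \<le> 3 * (half\<^sup>2 - dev\<^sup>2)"
    unfolding right_diff_distrib by (simp del: of_nat_add)
  have one: "2 * (half\<^sup>2 - (3 * int k - 1)\<^sup>2) \<le> half\<^sup>2 - dev\<^sup>2"
    using le unfolding right_diff_distrib by linarith
  have A: "?A \<subseteq> {1..n+k}" using m by auto
  have c: "chg ?A + chg ?A + rungs ?A ?A = 2"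
    using chg_prefix[of "n+m"] n m by (auto simp: rungs_def)
  have "int (sum dg ?A + sum dg ?A) - half = 2 * int n + 6 * int m - 3 * int k"
    using sum_dg_prefix[OF m(1)] n by (simp add: of_nat_diff del: of_nat_sum)
  then have d: "(int (sum dg ?A + sum dg ?A) - half)\<^sup>2 = dev\<^sup>2"
    using m(2) by (metis power2_abs)
  have "Mcut (R n k) = 2 * half / (real_of_int (half\<^sup>2 - dev\<^sup>2) / 2)"
  proof (rule Mcut_eqI[OF _ _ _ A A, unfolded c d])
    have le: "2 * a \<le> b \<Longrightarrow> real_of_int a \<le> real_of_int b / 2"
      "2 * a \<le> 3 * b \<Longrightarrow> real_of_int a \<le> 3 * (real_of_int b / 2)"
      "a \<le> b \<Longrightarrow> real_of_int a \<le> 2 * (real_of_int b / 2)" for a b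
      by linarith+
    show "real_of_int (half\<^sup>2 - (3 * int k - 1)\<^sup>2) \<le> real_of_int (half\<^sup>2 - dev\<^sup>2) / 2"
      by (rule le(1)[OF one])
    show "real_of_int (half\<^sup>2) \<le> 3 * (real_of_int (half\<^sup>2 - dev\<^sup>2) / 2)"
      by (rule le(2)[OF three])
    show "real_of_int (half\<^sup>2 - (int (sum dg A + sum dg B) - half)\<^sup>2) \<le> 2 * (real_of_int (half\<^sup>2 - dev\<^sup>2) / 2)"
      if "A \<subseteq> {1..n+k}" "B \<subseteq> {1..n+k}" "chg A + chg B + rungs A B = 2" for A B
      by (rule le(3)[OF two[OF that]])
  qed simp_all
  then show ?thesis by simp
qed

section \<open>The thresholds for the tail length\<close>

definition K :: real where
  "K = 1 - 3 * real k / 2 + sqrt (2 * (3 * real k - 1)\<^sup>2 - (real_of_int dev)\<^sup>2) / 2"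

text \<open>\<open>K\<close> is the larger solution for \<open>n\<close> of the equation between the
  two sides, the point where tail and ladder cuts tie.\<close>

lemma less_K_iff: "real n < K \<longleftrightarrow> half\<^sup>2 + dev\<^sup>2 < 2 * (3 * int k - 1)\<^sup>2"
proof -
  let ?h = "2 * real n + 3 * real k - 2" and ?x = "2 * (3 * real k - 1)\<^sup>2 - (real_of_int dev)\<^sup>2"
  have "0 \<le> ?h" using n by simp
  have "real n < K \<longleftrightarrow> ?h < sqrt ?x" unfolding K_def by (intro iffI) linarith+
  also have "\<dots> \<longleftrightarrow> sqrt (?h\<^sup>2) < sqrt ?x" using \<open>0 \<le> ?h\<close> by simp
  \<comment> \<open>\<open>sqrt\<close> is strictly increasing on all reals, so this holds whatever
    the sign of \<open>?x\<close>.\<close>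
  also have "\<dots> \<longleftrightarrow> ?h\<^sup>2 + (real_of_int dev)\<^sup>2 < 2 * (3 * real k - 1)\<^sup>2"
    unfolding real_sqrt_less_iff by linarith
  also have "\<dots> \<longleftrightarrow> real_of_int (half\<^sup>2 + dev\<^sup>2) < real_of_int (2 * (3 * int k - 1)\<^sup>2)"
    by simp
  finally show ?thesis unfolding of_int_less_iff .
qed

text \<open>When the tails are too long for \<open>cut_two\<close>, \<open>half\<close> is at least
  \<open>6 * k - 4\<close>, and the tail cut wins even against a two-edge cut of deviation
  0.\<close>

lemma long_tail:
  assumes "3 * k < 2 * n + 3"
  shows "2 * (3 * int k - 1)\<^sup>2 \<le> half\<^sup>2"
proof -
  have "(6 * int k - 4)\<^sup>2 \<le> half\<^sup>2" using assms k by (intro power_mono) auto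
  moreover have "2 * (3 * int k - 1)\<^sup>2 = (6 * int k - 4)\<^sup>2 - 18 * (int k - 1)\<^sup>2 + 4"
    by (simp add: power2_eq_square algebra_simps)
  moreover have "1\<^sup>2 \<le> (int k - 1)\<^sup>2" using k by (intro power_mono) auto
  ultimately show ?thesis by simp
qed

text \<open>By \<open>long_tail\<close>, being below the threshold already forces the length
  condition of \<open>Mcut_ladder\<close>.\<close>

lemma Mcut_below_K:
  assumes "3 \<le> k" "real n < K"
  shows "Mcut (R n k) = 4 * half / (half\<^sup>2 - dev\<^sup>2)"
proof -
  have lt: "half\<^sup>2 + dev\<^sup>2 < 2 * (3 * int k - 1)\<^sup>2" using assms less_K_iff by blast
  moreover have "0 \<le> dev\<^sup>2" by simp
  ultimately have "2 * n + 3 \<le> 3 * k" using long_tail by linarith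
  then show ?thesis using Mcut_ladder assms lt by simp
qed

lemma Mcut_above_K:
  assumes "3 \<le> k" "K \<le> real n"
  shows "Mcut (R n k) = 2 * half / (half\<^sup>2 - (3 * int k - 1)\<^sup>2)"
proof -
  have "\<not> half\<^sup>2 + dev\<^sup>2 < 2 * (3 * int k - 1)\<^sup>2" using assms less_K_iff by linarith
  then have "2 * (3 * int k - 1)\<^sup>2 \<le> half\<^sup>2 + dev\<^sup>2" by linarith
  then show ?thesis using long_tail assms(1) by (intro Mcut_tail) linarith
qed

end

section \<open>The exceptional smallest graph and the final case distinction\<close>

lemma Mcut_R_1_2: "Mcut (R 1 2) = 2 / 3"
proof -
  interpret roach 1 2 by unfold_locales auto
  have I: "{1..1+2} = {1, 2, 3 :: nat}" by auto
  have c: "chg {1, 2, 3} = 0" "chg {} = 0" "rungs {1, 2, 3} {} = 2"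
  proof -
    have "{i \<in> {1..<1+2}. (i \<in> {1, 2, 3}) \<noteq> (i + 1 \<in> {1, 2, 3 :: nat})} = {}"
      "{i \<in> {1+1..1+2}. (i \<in> {1, 2, 3}) \<noteq> (i \<in> ({} :: nat set))} = {2, 3}"
      by auto
    then show "chg {1, 2, 3} = 0" "chg {} = 0" "rungs {1, 2, 3} {} = 2"
      unfolding chg_def rungs_def by (simp_all only:) auto
  qed
  have v: "sum dg {1, 2, 3} = 6" by (simp add: dg_def del: One_nat_def)
  \<comment> \<open>The witness is one whole path: only two rungs cross, and its volume 6 is exactly
    half of 12. So \<open>q\<close> is \<open>36 / 2 = 18\<close>.\<close>
  have "Mcut (R 1 2) = 2 * (2 * int 1 + 3 * int 2 - 2) / 18"
    by (rule Mcut_eqI[of _ "{1, 2, 3}" "{}"]) (auto simp: I c v simp del: One_nat_def)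
  then show ?thesis by simp
qed

theorem theorem2:
  fixes n k :: nat and s K1 K2 K3 K4 :: real
  assumes n: "n \<ge> 1" and k: "k \<ge> 2"
    and s: "s = 3 * real k + 2 * real n"
    and K1: "K1 = 1 - 1 / sqrt 2 - 3 * real k / 2 + 3 * real k / sqrt 2"
    and K2: "K2 = 1 - 3 * real k / 2 + sqrt (1 - 12 * real k + 18 * (real k)^2) / 2"
    and K3: "K3 = 1 - 3 * real k / 2 + sqrt (- 1 - 6 * real k + 9 * (real k)^2) / sqrt 2"
    and K4: "K4 = 1 - 3 * real k / 2 + sqrt (- 7 - 12 * real k + 18 * (real k)^2) / 2"
  shows
    "(n = 1 \<and> k = 2 \<longrightarrow> Mcut (R n k) = 2 / 3) \<and>
     (k \<ge> 4 \<and> 3 dvd n \<and> 2 dvd k \<and> real n < K1 \<longrightarrow>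
        Mcut (R n k) = 4 / (s - 2)) \<and>
     (k \<ge> 4 \<and> 3 dvd n \<and> \<not> 2 dvd k \<and> real n < K4 \<longrightarrow>
        Mcut (R n k) = 4 * (s - 2) / ((s - 5) * (s + 1))) \<and>
     (k \<ge> 4 \<and> \<not> 3 dvd n \<and> 2 dvd k \<and> real n < K3 \<longrightarrow>
        Mcut (R n k) = 4 * (s - 2) / ((s - 4) * s)) \<and>
     ((k \<ge> 4 \<and> \<not> 3 dvd n \<and> \<not> 2 dvd k \<and> real n < K2) \<or>
      (n, k) = (1, 3) \<or> (n, k) = (2, 3) \<longrightarrow>
        Mcut (R n k) = 4 * (s - 2) / ((s - 3) * (s - 1))) \<and>
     ((k \<ge> 4 \<and>
        ((3 dvd n \<and> 2 dvd k \<and> K1 \<le> real n) \<or>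
         (3 dvd n \<and> \<not> 2 dvd k \<and> K4 \<le> real n) \<or>
         (\<not> 3 dvd n \<and> 2 dvd k \<and> K3 \<le> real n) \<or>
         (\<not> 3 dvd n \<and> \<not> 2 dvd k \<and> K2 \<le> real n))) \<or>
      (k = 2 \<and> n \<ge> 2) \<or> (k = 3 \<and> n \<ge> 3) \<longrightarrow>
        Mcut (R n k) = (6 * real k + 4 * real n - 4) / ((2 * real n - 1) * (6 * real k + 2 * real n - 3)))"
proof -
  interpret roach n k using n k by unfold_locales
  have half: "real_of_int half = s - 2" using s by simp
  have K1': "K1 = 1 - 3 * real k / 2 + sqrt (2 * (3 * real k - 1)\<^sup>2) / 2"
  proof -
    have "sqrt (2 * (3 * real k - 1)\<^sup>2) / 2 = (3 * real k - 1) / sqrt 2"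
      using k by (simp add: real_sqrt_mult field_simps)
    then show ?thesis unfolding K1 by (simp add: diff_divide_distrib)
  qed
  have K3': "K3 = 1 - 3 * real k / 2 + sqrt (2 * (- 1 - 6 * real k + 9 * (real k)\<^sup>2)) / 2"
    unfolding K3 real_sqrt_mult by (simp add: field_simps)
  \<comment> \<open>The values 0, 3, 2, 1 of \<open>dev\<close> turn \<open>K\<close> into
    \<open>K1\<close>, \<open>K4\<close>, \<open>K3\<close>, \<open>K2\<close>.\<close>
  have K_eq: "K = (if 3 dvd n then if even k then K1 else K4 else if even k then K3 else K2)"
    unfolding K_def dev_def K1' K2 K3' K4 by (auto simp: power2_eq_square algebra_simps)
  have tail: "2 * half / (half\<^sup>2 - (3 * int k - 1)\<^sup>2)
      = (6 * real k + 4 * real n - 4) / ((2 * real n - 1) * (6 * real k + 2 * real n - 3))"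
    by (intro arg_cong2[where f = "(/)"]) (simp_all add: power2_eq_square algebra_simps)
  have ladder: "4 * half / (half\<^sup>2 - dev\<^sup>2) = 4 * (s - 2) / ((s - 2 - dev) * (s - 2 + dev))"
    by (intro arg_cong2[where f = "(/)"]) (simp_all add: s power2_eq_square algebra_simps)
  have "s - 2 \<noteq> 0" using s n k by simp
  then have cancel: "4 * (s - 2) / ((s - 2) * (s - 2)) = 4 / (s - 2)"
    by (rule nonzero_mult_divide_mult_cancel_right)
  \<comment> \<open>Here \<open>half\<close> is 9 or 11, and both 82 and 122 stay below
    \<open>2 * 8\<^sup>2 = 128\<close>, so the ladder cut wins.\<close>
  have e: "Mcut (R n k) = 4 * (s - 2) / ((s - 3) * (s - 1))" if "(n, k) = (1, 3) \<or> (n, k) = (2, 3)"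
  proof -
    have "dev = 1" unfolding dev_def using that by auto
    then have "Mcut (R n k) = 4 * half / (half\<^sup>2 - dev\<^sup>2)"
      using that by (intro Mcut_ladder) auto
    then show ?thesis using \<open>dev = 1\<close> unfolding ladder by simp
  qed
  \<comment> \<open>For \<open>k = 2\<close> and \<open>k = 3\<close> the least values of
    \<open>half\<close> are 8 and 13; 50 is at most 64 and 128 at most 169.\<close>
  have f: "Mcut (R n k) = 2 * half / (half\<^sup>2 - (3 * int k - 1)\<^sup>2)"
    if "k = 2 \<and> n \<ge> 2 \<or> k = 3 \<and> n \<ge> 3"
  proof (rule Mcut_tail, rule disjI1)
    show "2 * (3 * int k - 1)\<^sup>2 \<le> half\<^sup>2"
      using that
    proof (elim disjE conjE)
      assume "k = 2" "n \<ge> 2"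
      then have "8\<^sup>2 \<le> half\<^sup>2" by (intro power_mono) auto
      then show ?thesis using \<open>k = 2\<close> by simp
    next
      assume "k = 3" "n \<ge> 3"
      then have "13\<^sup>2 \<le> half\<^sup>2" by (intro power_mono) auto
      then show ?thesis using \<open>k = 3\<close> by simp
    qed
  qed
  have below: "Mcut (R n k) = 4 * (s - 2) / ((s - 2 - dev) * (s - 2 + dev))"
    if "4 \<le> k" "real n < K"
    using Mcut_below_K that ladder by simp
  have above: "Mcut (R n k) = 2 * half / (half\<^sup>2 - (3 * int k - 1)\<^sup>2)"
    if "4 \<le> k" "K \<le> real n"
    using Mcut_above_K that by simp
  show ?thesis
  proof (intro conjI impI)
    assume "n = 1 \<and> k = 2"
    then show "Mcut (R n k) = 2 / 3" using Mcut_R_1_2 by simp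
  next
    assume "k \<ge> 4 \<and> 3 dvd n \<and> 2 dvd k \<and> real n < K1"
    then show "Mcut (R n k) = 4 / (s - 2)"
      using below cancel by (simp add: K_eq dev_def)
  next
    assume "k \<ge> 4 \<and> 3 dvd n \<and> \<not> 2 dvd k \<and> real n < K4"
    then show "Mcut (R n k) = 4 * (s - 2) / ((s - 5) * (s + 1))"
      using below by (simp add: K_eq dev_def)
  next
    assume "k \<ge> 4 \<and> \<not> 3 dvd n \<and> 2 dvd k \<and> real n < K3"
    then show "Mcut (R n k) = 4 * (s - 2) / ((s - 4) * s)"
      using below by (simp add: K_eq dev_def)
  next
    assume "(k \<ge> 4 \<and> \<not> 3 dvd n \<and> \<not> 2 dvd k \<and> real n < K2) \<or>
      (n, k) = (1, 3) \<or> (n, k) = (2, 3)"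
    then show "Mcut (R n k) = 4 * (s - 2) / ((s - 3) * (s - 1))"
    proof
      assume "k \<ge> 4 \<and> \<not> 3 dvd n \<and> \<not> 2 dvd k \<and> real n < K2"
      then show ?thesis using below by (simp add: K_eq dev_def)
    qed (rule e)
  next
    assume "(k \<ge> 4 \<and>
        ((3 dvd n \<and> 2 dvd k \<and> K1 \<le> real n) \<or>
         (3 dvd n \<and> \<not> 2 dvd k \<and> K4 \<le> real n) \<or>
         (\<not> 3 dvd n \<and> 2 dvd k \<and> K3 \<le> real n) \<or>
         (\<not> 3 dvd n \<and> \<not> 2 dvd k \<and> K2 \<le> real n))) \<or>
      (k = 2 \<and> n \<ge> 2) \<or> (k = 3 \<and> n \<ge> 3)"
    then have "4 \<le> k \<and> K \<le> real n \<or> k = 2 \<and> n \<ge> 2 \<or> k = 3 \<and> n \<ge> 3"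
      unfolding K_eq by presburger
    then show "Mcut (R n k)
        = (6 * real k + 4 * real n - 4) / ((2 * real n - 1) * (6 * real k + 2 * real n - 3))"
      unfolding tail[symmetric] using above f by blast
  qed
qed

end
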